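(* Let $\{l_{\mathrm R}(i)\in\{0,1\}\}_{i\in\mathbb{N}_0}$ be a time-inhomogeneous Markov chain with transition probabilities $p_{q,r}(i)$, and let $p_1\in(0,1)$ satisfy $p_{q,1}(i)\le p_1$ for all $q\in\{0,1\}$, $i\in\mathbb{N}_0$. Let $\{l_{\mathrm M}(i)\in\{0,1\}\}_{i\in\mathbb{N}_0}$ be a binary-valued process on the same probability space (not necessarily independent of $l_{\mathrm R}$) for which there is a scalar $\rho_{\mathrm M}\in[0,1]$ with $$\sum_{k=1}^{\infty}\mathbb{P}\Big[\sum_{i=0}^{k-1}l_{\mathrm M}(i)>\rho_{\mathrm M}k\Big]<\infty .$$ Define $l(i)=1$ if $l_{\mathrm R}(i)=1$ or $l_{\mathrm M}(i)=1$, and $l(i)=0$ otherwise, and let $L(k)\triangleq\sum_{i=0}^{k-1}l(i)$, $k\in\mathbb{N}$. If $$p_1+\rho_{\mathrm M}<1,$$ then $$\sum_{k=1}^{\infty}\mathbb{P}[L(k)>\rho k]<\infty\quad\text{for all }\rho\in(p_1+\rho_{\mathrm M},1).$$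
   Context: $\mathbb{N}$ and $\mathbb{N}_0$ denote the positive and nonnegative integers. The time-inhomogeneous Markov chain $\{l_{\mathrm R}(i)\}$ has an arbitrary initial distribution on $\{0,1\}$ and transition probabilities $p_{q,r}:\mathbb{N}_0\to[0,1]$, $\mathbb{P}[l_{\mathrm R}(i+1)=r\mid l_{\mathrm R}(i)=q]=p_{q,r}(i)$, $q,r\in\{0,1\}$. (Here $l_{\mathrm R}$ models random packet losses, $l_{\mathrm M}$ malicious attacks, and $l$ overall packet exchange failures.) *)

theory Defs
  imports "HOL-Probability.Probability"
begin

(* Measurability into count_space S also forces all values on space M to lie in S. *)
definition discrete_process :: "'a measure \<Rightarrow> 's set \<Rightarrow> (nat \<Rightarrow> 'a \<Rightarrow> 's) \<Rightarrow> bool" where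
  "discrete_process M S X \<longleftrightarrow> (\<forall>i. X i \<in> M \<rightarrow>\<^sub>M count_space S)"

(* Time-inhomogeneous Markov chain (arbitrary initial law) on a countable state space S, with
   p q r i the probability of moving from q at time i to r at time i + 1.  Both conditional
   probability requirements apply only where the conditioning event has positive probability,
   since cond_prob is 0 by convention otherwise.  Hence the row sums of p are determined (to be 1)
   exactly at the states that are visited with positive probability; nothing is imposed elsewhere
   beyond values in [0,1]. *)
definition markov_chain ::
  "'a measure \<Rightarrow> 's set \<Rightarrow> ('s \<Rightarrow> 's \<Rightarrow> nat \<Rightarrow> real) \<Rightarrow> (nat \<Rightarrow> 'a \<Rightarrow> 's) \<Rightarrow> bool" where
  "markov_chain M S p X \<longleftrightarrow>
     discrete_process M S X \<and>
     (\<forall>q\<in>S. \<forall>r\<in>S. \<forall>i. p q r i \<in> {0..1}) \<and>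
     (\<forall>i. \<forall>r\<in>S. \<forall>h. (\<forall>j\<le>i. h j \<in> S) \<longrightarrow> \<P>(\<omega> in M. \<forall>j\<le>i. X j \<omega> = h j) > 0 \<longrightarrow>
        \<P>(\<omega> in M. X (Suc i) \<omega> = r \<bar> \<forall>j\<le>i. X j \<omega> = h j) =
        \<P>(\<omega> in M. X (Suc i) \<omega> = r \<bar> X i \<omega> = h i)) \<and>
     (\<forall>i. \<forall>q\<in>S. \<forall>r\<in>S. \<P>(\<omega> in M. X i \<omega> = q) > 0 \<longrightarrow>
        \<P>(\<omega> in M. X (Suc i) \<omega> = r \<bar> X i \<omega> = q) = p q r i)"

definition exchange_failure ::
  "(nat \<Rightarrow> 'a \<Rightarrow> nat) \<Rightarrow> (nat \<Rightarrow> 'a \<Rightarrow> nat) \<Rightarrow> nat \<Rightarrow> 'a \<Rightarrow> nat" where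
  "exchange_failure lR lM i \<omega> = (if lR i \<omega> = 1 \<or> lM i \<omega> = 1 then 1 else 0)"

definition total_failures :: "(nat \<Rightarrow> 'a \<Rightarrow> nat) \<Rightarrow> nat \<Rightarrow> 'a \<Rightarrow> nat" where
  "total_failures l k \<omega> = (\<Sum>i = 0..<k. l i \<omega>)"

end

theory Submission
  imports Defs
begin

text \<open>Since \<open>l = max lR lM\<close> is at most \<open>lR + lM\<close>, the event \<open>L k > \<rho> k\<close> forces \<open>lM\<close> to exceed
  \<open>\<rho>M k\<close> or \<open>lR\<close> to exceed \<open>(\<rho> - \<rho>M) k\<close>, where \<open>\<rho> - \<rho>M > p1\<close>. Conditioning on the whole history
  shows that each step after the first multiplies \<open>E exp (t * (\<Sum>i<k. lR i))\<close> by at most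
  \<open>1 + p1 * (exp t - 1)\<close>, so Chernoff's bound with a small \<open>t > 0\<close> makes the second probability
  geometrically small.\<close>

section \<open>Measurability and integrability for discrete processes\<close>

lemma discrete_process_in:
  "discrete_process M S X \<Longrightarrow> \<omega> \<in> space M \<Longrightarrow> X j \<omega> \<in> S"
  unfolding discrete_process_def by (metis measurable_space space_count_space)

text \<open>The value \<open>x\<close> ranges over the whole type: inside \<open>S\<close> the event
  is the preimage of a measurable singleton, outside \<open>S\<close> it is empty because
  measurability into \<open>count_space S\<close> confines \<open>X j\<close> to
  \<open>S\<close>.\<close>

lemma discrete_process_sets:
  assumes "discrete_process M S X"
  shows "{\<omega> \<in> space M. X j \<omega> = x} \<in> sets M"
proof (cases "x \<in> S")
  case True
  have "X j \<in> M \<rightarrow>\<^sub>M count_space S" using assms by (simp add: discrete_process_def)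
  then have "X j -` {x} \<inter> space M \<in> sets M"
    using True by (intro measurable_sets[where A = "count_space S"]) auto
  moreover have "X j -` {x} \<inter> space M = {\<omega> \<in> space M. X j \<omega> = x}" by auto
  ultimately show ?thesis by metis
next
  case False
  then have "{\<omega> \<in> space M. X j \<omega> = x} = {}"
    using discrete_process_in[OF assms] by blast
  then show ?thesis by (metis sets.empty_sets)
qed

lemma discrete_process_measurable:
  assumes "discrete_process M S X" and "f \<in> S \<rightarrow> space N"
  shows "(\<lambda>\<omega>. f (X j \<omega>)) \<in> M \<rightarrow>\<^sub>M N"
proof (rule measurable_compose[where f = "X j" and g = f])
  show "X j \<in> M \<rightarrow>\<^sub>M count_space S" using assms by (simp add: discrete_process_def)
  show "f \<in> count_space S \<rightarrow>\<^sub>M N" using assms by simp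
qed

text \<open>The sum lies between 0 and \<open>k\<close>, so for \<open>0 \<le> t\<close> the
  exponential is bounded by the constant \<open>exp (t * real k)\<close>.\<close>

lemma binary_process_exp_sum_integrable:
  fixes X :: "nat \<Rightarrow> 'a \<Rightarrow> nat"
  assumes "prob_space M" and X: "discrete_process M {0, 1} X" and "0 \<le> t"
  shows "integrable M (\<lambda>\<omega>. exp (t * real (\<Sum>i = 0..<k. X i \<omega>)))"
proof -
  interpret prob_space M by fact
  have [measurable]: "(\<lambda>\<omega>. real (X j \<omega>)) \<in> borel_measurable M" for j
    by (rule discrete_process_measurable[OF X]) simp
  show ?thesis
  proof (rule integrable_const_bound)
    show "AE \<omega> in M. norm (exp (t * real (\<Sum>i = 0..<k. X i \<omega>))) \<le> exp (t * real k)"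
    proof (rule AE_I2)
      fix \<omega> assume "\<omega> \<in> space M"
      then have "X i \<omega> \<le> 1" for i
        using discrete_process_in[OF X, of \<omega> i] by auto
      then have "(\<Sum>i = 0..<k. X i \<omega>) \<le> k"
        using sum_bounded_above[of "{0..<k}" "\<lambda>i. X i \<omega>" 1] by simp
      then show "norm (exp (t * real (\<Sum>i = 0..<k. X i \<omega>))) \<le> exp (t * real k)"
        using \<open>0 \<le> t\<close> by (auto intro!: mult_left_mono simp del: of_nat_sum)
    qed
  qed simp
qed

section \<open>One-step estimates conditional on the history\<close>

text \<open>The Markov property reduces conditioning on the history to conditioning on its last
  state \<open>h i\<close>, from which the chain moves to \<open>r\<close> with probability
  \<open>p (h i) r i\<close>. The product form, in place of a conditional probability, covers null
  histories as well.\<close>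

lemma markov_chain_history_le:
  fixes p :: "'s \<Rightarrow> 's \<Rightarrow> nat \<Rightarrow> real"
  assumes "prob_space M" and chain: "markov_chain M S p X"
    and r: "r \<in> S" and h: "\<And>j. j \<le> i \<Longrightarrow> h j \<in> S"
    and le: "\<And>q. q \<in> S \<Longrightarrow> p q r i \<le> c"
  shows "\<P>(\<omega> in M. X (Suc i) \<omega> = r \<and> (\<forall>j\<le>i. X j \<omega> = h j))
    \<le> c * \<P>(\<omega> in M. \<forall>j\<le>i. X j \<omega> = h j)"
proof -
  interpret prob_space M by fact
  have X: "discrete_process M S X" using chain by (simp add: markov_chain_def)
  note sing = discrete_process_sets[OF X]
  have hist: "{\<omega> \<in> space M. \<forall>j\<le>i. X j \<omega> = h j} \<in> events"
    using sing by (intro sets.sets_Collect_countable_All sets.sets_Collect) auto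
  let ?H = "\<P>(\<omega> in M. \<forall>j\<le>i. X j \<omega> = h j)"
  show ?thesis
  proof (cases "?H > 0")
    case True
    \<comment> \<open>The chain is tied to \<open>p\<close> only at states of positive probability;
      \<open>h i\<close> inherits this from the history that ends in it.\<close>
    have "?H \<le> \<P>(\<omega> in M. X i \<omega> = h i)"
      using sing by (intro finite_measure_mono) auto
    with True have pos: "\<P>(\<omega> in M. X i \<omega> = h i) > 0" by linarith
    have "\<P>(\<omega> in M. X (Suc i) \<omega> = r \<bar> \<forall>j\<le>i. X j \<omega> = h j)
        = \<P>(\<omega> in M. X (Suc i) \<omega> = r \<bar> X i \<omega> = h i)"
      using chain r h True unfolding markov_chain_def by blast
    also have "\<dots> = p (h i) r i"
      using chain r h pos unfolding markov_chain_def by blast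
    also have "\<dots> \<le> c" using le h by simp
    finally show ?thesis
      using True by (simp add: cond_prob_def divide_le_eq)
  next
    case False
    \<comment> \<open>\<open>cond_prob\<close> says nothing on a null history, but there both sides
      are 0.\<close>
    then have "?H = 0" by (simp add: zero_less_measure_iff)
    moreover have "\<P>(\<omega> in M. X (Suc i) \<omega> = r \<and> (\<forall>j\<le>i. X j \<omega> = h j)) \<le> ?H"
      by (rule finite_measure_mono[OF _ hist]) blast
    ultimately show ?thesis by simp
  qed
qed

text \<open>Any function \<open>f\<close> of the path up to time \<open>i\<close> is a finite combination of indicators of
  cylinders, which reduces the claim to \<open>markov_chain_history_le\<close>.\<close>

lemma markov_chain_expectation_step_le:
  fixes p :: "'s \<Rightarrow> 's \<Rightarrow> nat \<Rightarrow> real" and f :: "(nat \<Rightarrow> 's) \<Rightarrow> real"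
  assumes "prob_space M" and chain: "markov_chain M S p X" and "finite S"
    and r: "r \<in> S" and le: "\<And>q. q \<in> S \<Longrightarrow> p q r i \<le> c"
    and f_nonneg: "\<And>h. 0 \<le> f h"
  defines "g \<equiv> \<lambda>\<omega>. f (restrict (\<lambda>j. X j \<omega>) {..i})"
  shows "(\<integral>\<omega>. g \<omega> * of_bool (X (Suc i) \<omega> = r) \<partial>M) \<le> c * (\<integral>\<omega>. g \<omega> \<partial>M)"
proof -
  interpret prob_space M by fact
  have X: "discrete_process M S X" using chain by (simp add: markov_chain_def)
  note sing = discrete_process_sets[OF X]
  let ?Hs = "{..i} \<rightarrow>\<^sub>E S"
  define A where "A h = {\<omega> \<in> space M. \<forall>j\<le>i. X j \<omega> = h j}" for h
  define B where "B = {\<omega> \<in> space M. X (Suc i) \<omega> = r}"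
  have A: "A h \<in> events" for h
    unfolding A_def using sing by (intro sets.sets_Collect_countable_All sets.sets_Collect) auto
  have B: "B \<in> events" unfolding B_def by (rule sing)
  have fin: "finite ?Hs" using \<open>finite S\<close> by (intro finite_PiE) auto
  have g_eq: "g \<omega> = (\<Sum>h\<in>?Hs. f h * indicator (A h) \<omega>)" if "\<omega> \<in> space M" for \<omega>
  proof -
    let ?h = "restrict (\<lambda>j. X j \<omega>) {..i}"
    have h: "?h \<in> ?Hs" using discrete_process_in[OF X that] by auto
    \<comment> \<open>Elements of \<open>?Hs\<close> are \<open>undefined\<close> outside
      \<open>{..i}\<close>, so agreeing with the path up to \<open>i\<close> means being equal to
      \<open>?h\<close>: exactly one cylinder contains \<omega>.\<close>
    have "indicator (A h) \<omega> = (of_bool (h = ?h) :: real)" if "h \<in> ?Hs" for h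
    proof -
      have "\<omega> \<in> A h \<longleftrightarrow> h = ?h"
        using that \<open>\<omega> \<in> space M\<close> by (auto simp: A_def PiE_iff extensional_def)
      then show ?thesis by (simp add: indicator_def)
    qed
    then have "(\<Sum>h\<in>?Hs. f h * indicator (A h) \<omega>) = (\<Sum>h\<in>?Hs. if h = ?h then f h else 0)"
      by (intro sum.cong) auto
    also have "\<dots> = g \<omega>" using fin h by (simp add: g_def)
    finally show ?thesis by simp
  qed
  have gB_eq: "g \<omega> * of_bool (X (Suc i) \<omega> = r) = (\<Sum>h\<in>?Hs. f h * indicator (B \<inter> A h) \<omega>)"
    if "\<omega> \<in> space M" for \<omega>
    using g_eq[OF that] that by (auto simp: B_def indicator_def)
  have "(\<integral>\<omega>. g \<omega> * of_bool (X (Suc i) \<omega> = r) \<partial>M)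
      = (\<integral>\<omega>. (\<Sum>h\<in>?Hs. f h * indicator (B \<inter> A h) \<omega>) \<partial>M)"
    by (intro Bochner_Integration.integral_cong gB_eq refl)
  also have "\<dots> = (\<Sum>h\<in>?Hs. f h * prob (B \<inter> A h))"
    using A B by (subst Bochner_Integration.integral_sum) (auto simp: emeasure_eq_measure)
  \<comment> \<open>Nonnegativity of \<open>f\<close> lets the cylinder bound be applied term by
    term.\<close>
  also have "\<dots> \<le> (\<Sum>h\<in>?Hs. f h * (c * prob (A h)))"
  proof (intro sum_mono mult_left_mono f_nonneg)
    fix h assume "h \<in> ?Hs"
    then have "\<P>(\<omega> in M. X (Suc i) \<omega> = r \<and> (\<forall>j\<le>i. X j \<omega> = h j))
      \<le> c * \<P>(\<omega> in M. \<forall>j\<le>i. X j \<omega> = h j)"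
      using r le by (intro markov_chain_history_le[OF \<open>prob_space M\<close> chain]) auto
    moreover have "B \<inter> A h = {\<omega> \<in> space M. X (Suc i) \<omega> = r \<and> (\<forall>j\<le>i. X j \<omega> = h j)}"
      by (auto simp: A_def B_def)
    ultimately show "prob (B \<inter> A h) \<le> c * prob (A h)" by (simp add: A_def)
  qed
  also have "\<dots> = c * (\<Sum>h\<in>?Hs. f h * prob (A h))"
    by (simp add: sum_distrib_left mult.left_commute)
  also have "(\<Sum>h\<in>?Hs. f h * prob (A h)) = (\<integral>\<omega>. (\<Sum>h\<in>?Hs. f h * indicator (A h) \<omega>) \<partial>M)"
    using A by (subst Bochner_Integration.integral_sum) (auto simp: emeasure_eq_measure)
  also have "\<dots> = (\<integral>\<omega>. g \<omega> \<partial>M)"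
    by (intro Bochner_Integration.integral_cong g_eq[symmetric] refl)
  finally show ?thesis .
qed

section \<open>Exponential moments and the Chernoff bound\<close>

text \<open>The initial law is arbitrary, so \<open>X 0\<close> is only bounded by 1; this costs the
  constant \<open>exp t\<close>, which is harmless for summability.\<close>

lemma markov_chain_exp_sum_le:
  fixes p :: "nat \<Rightarrow> nat \<Rightarrow> nat \<Rightarrow> real"
  assumes "prob_space M" and chain: "markov_chain M {0, 1} p X"
    and le: "\<And>q i. q \<in> {0, 1} \<Longrightarrow> p q 1 i \<le> c" and "0 \<le> c" and "0 \<le> t"
  shows "(\<integral>\<omega>. exp (t * real (\<Sum>i = 0..<k. X i \<omega>)) \<partial>M) \<le> exp t * (1 + c * (exp t - 1)) ^ k"
proof -
  interpret prob_space M by fact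
  have X: "discrete_process M {0, 1} X" using chain by (simp add: markov_chain_def)
  have X01: "X j \<omega> = 0 \<or> X j \<omega> = 1" if "\<omega> \<in> space M" for j \<omega>
    using discrete_process_in[OF X that] by blast
  define E where "E k \<omega> = exp (t * real (\<Sum>i = 0..<k. X i \<omega>))" for k \<omega>
  have E_int: "integrable M (E k)" for k
    unfolding E_def using assms X by (intro binary_process_exp_sum_integrable)
  have factor_ge_1: "1 \<le> 1 + c * (exp t - 1)" using \<open>0 \<le> c\<close> \<open>0 \<le> t\<close> by simp
  have step: "expectation (E (Suc (Suc i))) \<le> (1 + c * (exp t - 1)) * expectation (E (Suc i))" for i
  proof -
    have [measurable]: "(\<lambda>\<omega>. of_bool (X (Suc i) \<omega> = 1) :: real) \<in> borel_measurable M"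
      by (rule discrete_process_measurable[OF X]) simp
    note borel_measurable_integrable[OF E_int, measurable]
    have int: "integrable M (\<lambda>\<omega>. E (Suc i) \<omega> * of_bool (X (Suc i) \<omega> = 1))"
      by (rule Bochner_Integration.integrable_bound[OF E_int[of "Suc i"]])
        (auto simp del: One_nat_def)
    \<comment> \<open>For \<open>x\<close> in \<open>{0, 1}\<close>,
      \<open>exp (t * x) = 1 + (exp t - 1) * of_bool (x = 1)\<close>, which makes the last factor
      affine in an indicator.\<close>
    have "E (Suc (Suc i)) \<omega>
        = E (Suc i) \<omega> + (exp t - 1) * (E (Suc i) \<omega> * of_bool (X (Suc i) \<omega> = 1))"
      if "\<omega> \<in> space M" for \<omega>
      using X01[OF that, of "Suc i"] by (auto simp: E_def algebra_simps exp_add)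
    then have "expectation (E (Suc (Suc i)))
        = (\<integral>\<omega>. E (Suc i) \<omega> + (exp t - 1) * (E (Suc i) \<omega> * of_bool (X (Suc i) \<omega> = 1)) \<partial>M)"
      by (intro Bochner_Integration.integral_cong refl)
    also have "\<dots> = expectation (E (Suc i))
        + (exp t - 1) * (\<integral>\<omega>. E (Suc i) \<omega> * of_bool (X (Suc i) \<omega> = 1) \<partial>M)"
      using E_int int by simp
    also have "\<dots> \<le> expectation (E (Suc i)) + (exp t - 1) * (c * expectation (E (Suc i)))"
    proof (intro add_left_mono mult_left_mono)
      \<comment> \<open>\<open>E (Suc i)\<close> involves the times 0 to \<open>i\<close> only, that
        is, the history preceding \<open>X (Suc i)\<close>.\<close>
      have "E (Suc i) = (\<lambda>\<omega>. exp (t * real (\<Sum>j\<le>i. restrict (\<lambda>j. X j \<omega>) {..i} j)))"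
        unfolding E_def atLeast0LessThan lessThan_Suc_atMost by (intro ext) (simp cong: sum.cong_simp)
      then show "(\<integral>\<omega>. E (Suc i) \<omega> * of_bool (X (Suc i) \<omega> = 1) \<partial>M) \<le> c * expectation (E (Suc i))"
        using markov_chain_expectation_step_le[OF \<open>prob_space M\<close> chain, of 1 i c
            "\<lambda>h. exp (t * real (\<Sum>j\<le>i. h j))"] le by (simp del: of_nat_sum)
    qed (use \<open>0 \<le> t\<close> in simp)
    finally show ?thesis by (simp add: algebra_simps)
  qed
  have Suc_le: "expectation (E (Suc i)) \<le> exp t * (1 + c * (exp t - 1)) ^ i" for i
  proof (induction i)
    case 0
    have "expectation (E (Suc 0)) \<le> expectation (\<lambda>\<omega>. exp t)"
    proof (intro integral_mono E_int)
      fix \<omega> assume "\<omega> \<in> space M"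
      then show "E (Suc 0) \<omega> \<le> exp t"
        using X01[of \<omega> 0] \<open>0 \<le> t\<close> by (auto simp: E_def)
    qed simp
    then show ?case by (simp add: prob_space)
  next
    case (Suc i)
    have "expectation (E (Suc (Suc i))) \<le> (1 + c * (exp t - 1)) * expectation (E (Suc i))"
      by (rule step)
    also have "\<dots> \<le> (1 + c * (exp t - 1)) * (exp t * (1 + c * (exp t - 1)) ^ i)"
      using Suc factor_ge_1 by (intro mult_left_mono) auto
    finally show ?case by (simp add: mult.left_commute)
  qed
  show ?thesis
  proof (cases k)
    case 0
    then show ?thesis using \<open>0 \<le> t\<close> by (simp add: prob_space)
  next
    case (Suc i)
    \<comment> \<open>Only \<open>i = k - 1\<close> transitions occur; since the factor is at least
      1, the exponent may be raised to \<open>k\<close>, giving one formula that also covers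
      \<open>k = 0\<close>.\<close>
    have "expectation (E k) \<le> exp t * (1 + c * (exp t - 1)) ^ i"
      using Suc_le Suc by simp
    also have "\<dots> \<le> exp t * (1 + c * (exp t - 1)) ^ k"
      using Suc factor_ge_1 by (intro mult_left_mono power_increasing) auto
    finally show ?thesis unfolding E_def .
  qed
qed

lemma markov_chain_sum_tail_summable:
  fixes p :: "nat \<Rightarrow> nat \<Rightarrow> nat \<Rightarrow> real"
  assumes "prob_space M" and chain: "markov_chain M {0, 1} p X"
    and le: "\<And>q i. q \<in> {0, 1} \<Longrightarrow> p q 1 i \<le> c" and "0 < c" and "c < \<rho>"
  shows "summable (\<lambda>k. \<P>(\<omega> in M. real (\<Sum>i = 0..<k. X i \<omega>) > \<rho> * real k))"
proof -
  interpret prob_space M by fact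
  have X: "discrete_process M {0, 1} X" using chain by (simp add: markov_chain_def)
  \<comment> \<open>\<open>exp t - 1 \<le> t + t\<^sup>2\<close> on \<open>[0, 1]\<close>, so \<open>c * (exp t - 1) < \<rho> * t\<close> as soon as \<open>c * (1 + t) < \<rho>\<close>.\<close>
  define t where "t = min 1 ((\<rho> - c) / (2 * c))"
  have t: "0 < t" "t \<le> 1" using assms by (auto simp: t_def)
  \<comment> \<open>The second argument of \<open>min\<close> is chosen so that
    \<open>c * (1 + t)\<close> stays at or below the midpoint of \<open>c\<close> and
    \<rho>.\<close>
  have "c * t \<le> (\<rho> - c) / 2"
    using \<open>0 < c\<close> mult_left_mono[of t "(\<rho> - c) / (2 * c)" c] by (simp add: t_def)
  then have "c * (1 + t) < \<rho>" using \<open>c < \<rho>\<close> by (simp add: algebra_simps)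
  have "c * (exp t - 1) \<le> c * (t + t\<^sup>2)"
    using exp_bound[of t] t \<open>0 < c\<close> by (intro mult_left_mono) auto
  also have "\<dots> = c * (1 + t) * t" by (simp add: power2_eq_square algebra_simps)
  also have "\<dots> < \<rho> * t" using \<open>c * (1 + t) < \<rho>\<close> t by simp
  finally have exponent: "c * (exp t - 1) < \<rho> * t" .
  \<comment> \<open>The ratio of the Chernoff bound: growth of the exponential moment per step,
    divided by growth of the threshold \<open>exp (t * (\<rho> * k))\<close>. It is below 1 by
    \<open>1 + y \<le> exp y\<close> and the inequality \<open>exponent\<close>.\<close>
  define x where "x = (1 + c * (exp t - 1)) * exp (- (\<rho> * t))"
  have x_nonneg: "0 \<le> x" using t \<open>0 < c\<close> by (simp add: x_def)
  have "x \<le> exp (c * (exp t - 1)) * exp (- (\<rho> * t))"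
    unfolding x_def by (intro mult_right_mono exp_ge_add_one_self) auto
  also have "\<dots> < 1" using exponent by (simp flip: exp_add)
  finally have "x < 1" .
  have tail: "\<P>(\<omega> in M. real (\<Sum>i = 0..<k. X i \<omega>) > \<rho> * real k) \<le> exp t * x ^ k" for k
  proof -
    let ?E = "\<lambda>\<omega>. exp (t * real (\<Sum>i = 0..<k. X i \<omega>))"
    have int: "integrable M ?E"
      using t by (intro binary_process_exp_sum_integrable[OF \<open>prob_space M\<close> X]) simp
    have [measurable]: "(\<lambda>\<omega>. real (X j \<omega>)) \<in> borel_measurable M" for j
      by (rule discrete_process_measurable[OF X]) simp
    have "\<P>(\<omega> in M. real (\<Sum>i = 0..<k. X i \<omega>) > \<rho> * real k)
        \<le> \<P>(\<omega> in M. ?E \<omega> \<ge> exp (t * (\<rho> * real k)))"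
      using t by (intro finite_measure_mono) auto
    also have "\<dots> \<le> (\<integral>\<omega>. ?E \<omega> \<partial>M) / exp (t * (\<rho> * real k))"
      by (rule integral_Markov_inequality_measure[OF int, of "{}"]) auto
    also have "\<dots> \<le> exp t * (1 + c * (exp t - 1)) ^ k / exp (t * (\<rho> * real k))"
      using assms t by (intro divide_right_mono markov_chain_exp_sum_le[where p = p]) auto
    also have "\<dots> = exp t * x ^ k"
      by (simp add: x_def power_mult_distrib exp_minus divide_simps mult.commute mult.left_commute
          flip: exp_of_nat_mult)
    finally show ?thesis .
  qed
  show ?thesis
  proof (rule summable_comparison_test'[where N = 0])
    show "summable (\<lambda>k. exp t * x ^ k)"
      using x_nonneg \<open>x < 1\<close> by (intro summable_mult summable_geometric) simp
  qed (use tail in simp)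
qed

theorem proposition2p5:
  fixes M :: "'a measure"
    and lR lM :: "nat \<Rightarrow> 'a \<Rightarrow> nat"
    and p :: "nat \<Rightarrow> nat \<Rightarrow> nat \<Rightarrow> real"
    and p1 \<rho>M :: real
  assumes "prob_space M"
    and "markov_chain M {0, 1} p lR"
    and "p1 \<in> {0<..<1}"
    and "\<And>q i. q \<in> {0, 1} \<Longrightarrow> p q 1 i \<le> p1"
    and "discrete_process M {0, 1} lM"
    and "\<rho>M \<in> {0..1}"
    and "(\<lambda>k. \<P>(\<omega> in M. real (\<Sum>i = 0..<k. lM i \<omega>) > \<rho>M * real k)) summable_on {1..}"
    and "p1 + \<rho>M < 1"
  shows "\<forall>\<rho> \<in> {p1 + \<rho>M<..<1}.
    (\<lambda>k. \<P>(\<omega> in M. real (total_failures (exchange_failure lR lM) k \<omega>) > \<rho> * real k))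
      summable_on {1..}"
proof
  fix \<rho> assume \<rho>: "\<rho> \<in> {p1 + \<rho>M<..<1}"
  interpret prob_space M by fact
  have lR: "discrete_process M {0, 1} lR" using assms by (simp add: markov_chain_def)
  have [measurable]: "(\<lambda>\<omega>. real (lR j \<omega>)) \<in> borel_measurable M"
      "(\<lambda>\<omega>. real (lM j \<omega>)) \<in> borel_measurable M" for j
    by (rule discrete_process_measurable[OF lR] discrete_process_measurable[OF assms(5)]; simp)+
  let ?R = "\<lambda>k. \<P>(\<omega> in M. real (\<Sum>i = 0..<k. lR i \<omega>) > (\<rho> - \<rho>M) * real k)"
  let ?A = "\<lambda>k. \<P>(\<omega> in M. real (\<Sum>i = 0..<k. lM i \<omega>) > \<rho>M * real k)"
  have "summable ?R"
    using assms \<rho> by (intro markov_chain_sum_tail_summable[where p = p and c = p1]) auto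
  \<comment> \<open>Terms are nonnegative, so convergence of the series is absolute and gives
    unconditional summability; index 0 is then dropped.\<close>
  then have "?R summable_on {1..}"
    by (intro summable_on_subset_banach[OF norm_summable_imp_summable_on]) auto
  then have "(\<lambda>k. ?R k + ?A k) summable_on {1..}"
    using assms by (intro summable_on_add)
  then show "(\<lambda>k. \<P>(\<omega> in M. real (total_failures (exchange_failure lR lM) k \<omega>) > \<rho> * real k))
      summable_on {1..}"
  proof (rule summable_on_comparison_test)
    fix k
    have "total_failures (exchange_failure lR lM) k \<omega>
        \<le> (\<Sum>i = 0..<k. lR i \<omega>) + (\<Sum>i = 0..<k. lM i \<omega>)" for \<omega>
      unfolding total_failures_def exchange_failure_def sum.distrib[symmetric]
      by (intro sum_mono) auto
    then have le: "real (total_failures (exchange_failure lR lM) k \<omega>)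
        \<le> real (\<Sum>i = 0..<k. lR i \<omega>) + real (\<Sum>i = 0..<k. lM i \<omega>)" for \<omega>
      by (metis of_nat_add of_nat_le_iff)
    have "\<P>(\<omega> in M. real (total_failures (exchange_failure lR lM) k \<omega>) > \<rho> * real k)
        \<le> prob ({\<omega> \<in> space M. real (\<Sum>i = 0..<k. lR i \<omega>) > (\<rho> - \<rho>M) * real k}
          \<union> {\<omega> \<in> space M. real (\<Sum>i = 0..<k. lM i \<omega>) > \<rho>M * real k})"
    proof (rule finite_measure_mono, safe)
      fix \<omega>
      assume "real (total_failures (exchange_failure lR lM) k \<omega>) > \<rho> * real k"
        and "\<not> real (\<Sum>i = 0..<k. lM i \<omega>) > \<rho>M * real k"
      then show "real (\<Sum>i = 0..<k. lR i \<omega>) > (\<rho> - \<rho>M) * real k"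
        using le[of \<omega>] by (simp add: left_diff_distrib del: of_nat_sum)
    qed simp
    \<comment> \<open>The union bound holds for every joint law of \<open>lR\<close> and
      \<open>lM\<close>.\<close>
    also have "\<dots> \<le> ?R k + ?A k"
      by (rule measure_Un_le) simp_all
    finally show "\<P>(\<omega> in M. real (total_failures (exchange_failure lR lM) k \<omega>) > \<rho> * real k)
        \<le> ?R k + ?A k" .
  qed simp
qed

end
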